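(* There are exactly $52$ isomorphism classes of $2$-dimensional algebras over the field $\mathbb{F}_2$ with two elements.
   Context: An algebra over a field $\mathbb{F}$ is an $\mathbb{F}$-vector space $V$ with an arbitrary bilinear multiplication $\mu:V\times V\to V$ (no associativity, commutativity or unit is assumed). Two algebras $(V,\mu)$ and $(V',\mu')$ are isomorphic if there is a linear isomorphism $f:V\to V'$ with $f(\mu(X,Y))=\mu'(f(X),f(Y))$ for all $X,Y\in V$. *)

theory Defs
  imports "HOL-Analysis.Finite_Cartesian_Product" "HOL-Library.Z2"
begin

locale nonassoc_algebra = vector_space scale
  for scale :: "'f::field \<Rightarrow> 'v::ab_group_add \<Rightarrow> 'v" +
  fixes mu :: "'v \<Rightarrow> 'v \<Rightarrow> 'v"
  assumes linear_right: "Vector_Spaces.linear scale scale (\<lambda>y. mu x y)"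
    and linear_left: "Vector_Spaces.linear scale scale (\<lambda>x. mu x y)"

text \<open>An algebra is recorded as the pair of its scalar multiplication and its product;
  its carrier and its addition are those of the type \<open>'v\<close>.\<close>

type_synonym ('f, 'v) alg = "('f \<Rightarrow> 'v \<Rightarrow> 'v) \<times> ('v \<Rightarrow> 'v \<Rightarrow> 'v)"

text \<open>The library dimension is \<open>0\<close> for spaces that are not finite-dimensional,
  so dimension \<open>2\<close> includes finite-dimensionality.\<close>

definition two_dim_algebras :: "('f::field, 'v::ab_group_add) alg set" where
  "two_dim_algebras =
    {(scale, mu). nonassoc_algebra scale mu \<and> vector_space.dim scale (UNIV :: 'v set) = 2}"

definition alg_isomorphic ::
    "('f::field, 'v::ab_group_add) alg \<Rightarrow> ('f, 'w::ab_group_add) alg \<Rightarrow> bool" where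
  "alg_isomorphic = (\<lambda>(scale, mu) (scale', mu').
    \<exists>f. Vector_Spaces.linear scale scale' f \<and> bij f \<and> (\<forall>x y. f (mu x y) = mu' (f x) (f y)))"

definition two_dim_algebra_classes :: "('f::field, 'v::ab_group_add) alg set set" where
  "two_dim_algebra_classes = two_dim_algebras //
    {(A, B). A \<in> two_dim_algebras \<and> B \<in> two_dim_algebras \<and> alg_isomorphic A B}"

end

theory Submission
  imports Defs "HOL-Analysis.Cartesian_Space" "HOL-Library.Product_Lexorder"
begin

text \<open>
  Over the field with two elements the scalar multiplication is forced by the additive group, so a
  two-dimensional algebra is given by the \<open>2\<^sup>8\<close> possible tables of structure constants with respect
  to a basis of the plane. Any two distinct nonzero vectors form a basis, and two tables give
  isomorphic algebras iff one arises from the other by passing to one of these six bases. Ordering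
  the tables lexicographically, the isomorphism classes are counted by the tables that are minimal
  in their orbit, and an exhaustive check finds 52 of them.
\<close>

text \<open>Each class is finite and nonempty, so it has an element of least key, and injectivity of
  \<open>key\<close> makes that element unique. Counting classes thus becomes counting the elements
  that pass a test.\<close>

lemma card_quotient_minima:
  fixes key :: "'a \<Rightarrow> 'k::linorder"
  assumes equiv: "equiv A R" and fin: "finite A" and inj: "inj_on key A"
  shows "card (A // R) = card {a \<in> A. \<forall>b. (a, b) \<in> R \<longrightarrow> key a \<le> key b}"
proof -
  let ?M = "{a \<in> A. \<forall>b. (a, b) \<in> R \<longrightarrow> key a \<le> key b}"
  have "bij_betw (\<lambda>a. R `` {a}) ?M (A // R)"
  proof (rule bij_betw_imageI)
    show "inj_on (\<lambda>a. R `` {a}) ?M"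
    proof (rule inj_onI)
      fix a b assume a: "a \<in> ?M" and b: "b \<in> ?M" and eq: "R `` {a} = R `` {b}"
      then have "(a, b) \<in> R" "(b, a) \<in> R"
        using eq_equiv_class_iff[OF equiv] by blast+
      then have "key a = key b" using a b by (simp add: order_antisym)
      then show "a = b" using inj a b by (simp add: inj_on_def)
    qed
    show "(\<lambda>a. R `` {a}) ` ?M = A // R"
    proof
      show "(\<lambda>a. R `` {a}) ` ?M \<subseteq> A // R" by (auto intro: quotientI)
      show "A // R \<subseteq> (\<lambda>a. R `` {a}) ` ?M"
      proof
        fix C assume C: "C \<in> A // R"
        then have CA: "C \<subseteq> A" and ne: "C \<noteq> {}"
          using in_quotient_imp_subset[OF equiv] in_quotient_imp_non_empty[OF equiv] by auto
        then obtain a where a: "is_arg_min key (\<lambda>x. x \<in> C) a"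
          using ex_is_arg_min_if_finite[OF finite_subset[OF CA fin] ne] by blast
        then have aC: "a \<in> C" and min: "\<And>b. b \<in> C \<Longrightarrow> key a \<le> key b"
          by (auto simp: is_arg_min_def not_less)
        have "C = R `` {a}"
          using C aC equiv_class_eq[OF equiv] by (blast elim!: quotientE)
        then show "C \<in> (\<lambda>a. R `` {a}) ` ?M" using aC CA min by auto
      qed
    qed
  qed
  then show ?thesis by (simp add: bij_betw_same_card)
qed

subsection \<open>Isomorphism of algebras\<close>

lemma alg_isomorphic_refl:
  assumes "A \<in> two_dim_algebras"
  shows "alg_isomorphic A A"
proof -
  obtain s mu where A: "A = (s, mu)" by (cases A)
  then interpret nonassoc_algebra s mu using assms by (simp add: two_dim_algebras_def)
  show ?thesis unfolding A alg_isomorphic_def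
    using linear_id by (auto intro!: exI[of _ id])
qed

lemma alg_isomorphic_sym:
  assumes "alg_isomorphic A B"
  shows "alg_isomorphic B A"
proof -
  obtain s mu s' mu' where AB: "A = (s, mu)" "B = (s', mu')" by (cases A, cases B)
  obtain f where lin: "Vector_Spaces.linear s s' f" and f: "bij f"
    and hom: "\<And>x y. f (mu x y) = mu' (f x) (f y)"
    using assms by (auto simp: AB alg_isomorphic_def)
  \<comment> \<open>Every equation \<open>inv f z = x\<close> becomes an equation about
    \<open>f\<close>, so the claims about the inverse reduce to the properties of
    \<open>f\<close>.\<close>
  have inv: "inv f z = x \<longleftrightarrow> z = f x" for x z
    using f by (metis bij_inv_eq_iff)
  have "Vector_Spaces.linear s' s (inv f)"
    using lin f by (simp add: Vector_Spaces.linear_iff inv bij_is_surj surj_f_inv_f)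
  moreover have "bij (inv f)" using f by (rule bij_imp_bij_inv)
  moreover have "inv f (mu' x y) = mu (inv f x) (inv f y)" for x y
    using f by (simp add: inv hom bij_is_surj surj_f_inv_f)
  ultimately show ?thesis by (auto simp: AB alg_isomorphic_def)
qed

lemma alg_isomorphic_commute: "alg_isomorphic A B \<longleftrightarrow> alg_isomorphic B A"
  by (rule iffI; erule alg_isomorphic_sym)

lemma alg_isomorphic_trans:
  assumes "alg_isomorphic A B" "alg_isomorphic B C"
  shows "alg_isomorphic A C"
proof -
  obtain s mu s' mu' s'' mu''
    where ABC: "A = (s, mu)" "B = (s', mu')" "C = (s'', mu'')" by (cases A, cases B, cases C)
  obtain f where f: "Vector_Spaces.linear s s' f" "bij f" "\<And>x y. f (mu x y) = mu' (f x) (f y)"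
    using assms by (auto simp: ABC alg_isomorphic_def)
  obtain g where g: "Vector_Spaces.linear s' s'' g" "bij g" "\<And>x y. g (mu' x y) = mu'' (g x) (g y)"
    using assms by (auto simp: ABC alg_isomorphic_def)
  have "Vector_Spaces.linear s s'' (g \<circ> f)" "bij (g \<circ> f)"
    using f g by (auto simp: Vector_Spaces.linear_iff intro: bij_comp)
  then show ?thesis
    using f(3) g(3) by (auto simp: ABC alg_isomorphic_def intro!: exI[of _ "g \<circ> f"])
qed

lemma equiv_alg_isomorphic:
  "equiv two_dim_algebras
    {(A, B). A \<in> two_dim_algebras \<and> B \<in> two_dim_algebras \<and> alg_isomorphic A B}"
  by (rule equivI)
    (auto simp: refl_on_def sym_def trans_def
      intro: alg_isomorphic_refl alg_isomorphic_sym alg_isomorphic_trans)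

text \<open>Coordinates with respect to a basis \<open>b\<close>, \<open>c\<close> transport the
  product to \<open>'f ^ 2\<close>, so this one carrier represents all carrier types.\<close>

lemma two_dim_algebra_iso_standard:
  fixes A :: "('f::field, 'v::ab_group_add) alg"
  assumes "A \<in> two_dim_algebras"
  obtains B :: "('f, 'f ^ 2) alg" where "B \<in> two_dim_algebras" "alg_isomorphic A B"
proof -
  obtain s mu where A: "A = (s, mu)" by (cases A)
  then interpret nonassoc_algebra s mu using assms by (simp add: two_dim_algebras_def)
  have dim: "dim UNIV = 2" using assms A by (simp add: two_dim_algebras_def)
  obtain b c where ind: "independent {b, c}" and bc: "b \<noteq> c" and sp: "span {b, c} = UNIV"
    using basis_exists[of UNIV] dim by (metis card_2_iff top.extremum_uniqueI)
  define f where "f x = s (x $ 1) b + s (x $ 2) c" for x :: "'f ^ 2"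
  have lin: "Vector_Spaces.linear (*s) s f"
    unfolding Vector_Spaces.linear_iff
    using vec.vector_space_axioms vector_space_axioms
    by (auto simp: f_def scale_left_distrib scale_right_distrib)
  have "inj f"
  proof -
    have "x = 0" if "f x = 0" for x
    proof -
      have b: "b \<notin> span {c}" and c: "c \<notin> span {}"
        using ind bc by (auto simp: independent_insert split: if_splits)
      have 1: "x $ 1 = 0"
      \<comment> \<open>A nonzero first coordinate would make \<open>b\<close> a multiple of
        \<open>c\<close>, against independence.\<close>
      proof (rule ccontr)
        assume n: "x $ 1 \<noteq> 0"
        have "s (x $ 1) b = s (- (x $ 2)) c"
          using that by (simp add: f_def eq_neg_iff_add_eq_0)
        then have "s (x $ 1) b \<in> span {c}" by (metis span_base span_scale singletonI)
        then show False using span_scale[of _ "{c}" "inverse (x $ 1)"] b n by fastforce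
      qed
      then have "x $ 2 = 0" using that c by (auto simp: f_def)
      with 1 show ?thesis by (simp add: vec_eq_iff forall_2)
    qed
    then show ?thesis
      using module_hom.inj_iff_eq_0[OF lin[unfolded linear_iff_module_hom]] by blast
  qed
  moreover have "surj f"
  proof -
    have "\<exists>x. y = f x" for y
    proof -
      have "y \<in> span {b, c}" using sp by simp
      then obtain k l where "y - s k b = s l c"
        by (auto simp: span_insert span_singleton)
      then have "y = f (vector [k, l])" by (simp add: f_def algebra_simps)
      then show ?thesis ..
    qed
    then show ?thesis by (simp add: surj_def)
  qed
  ultimately have bij: "bij f" by (simp add: bij_def)
  have inv: "inv f z = x \<longleftrightarrow> z = f x" for x z
    using bij by (metis bij_inv_eq_iff)
  have finv: "f (inv f z) = z" for z
    using bij by (simp add: bij_is_surj surj_f_inv_f)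
  define mu' where "mu' x y = inv f (mu (f x) (f y))" for x y
  have lin_inv: "Vector_Spaces.linear s (*s) (inv f)"
    using lin by (simp add: Vector_Spaces.linear_iff inv finv)
  have "nonassoc_algebra (*s) mu'"
    unfolding nonassoc_algebra_def nonassoc_algebra_axioms_def
    using lin lin_inv linear_left linear_right
    by (simp add: Vector_Spaces.linear_iff mu'_def)
  then have "((*s), mu') \<in> two_dim_algebras"
    by (simp add: two_dim_algebras_def card_cart_basis)
  moreover have "alg_isomorphic ((*s), mu') A"
    unfolding A alg_isomorphic_def using lin bij by (auto simp: mu'_def finv)
  ultimately show thesis using that alg_isomorphic_sym by blast
qed

subsection \<open>Structure constants over the field with two elements\<close>

text \<open>Booleans stand for the two field elements: products of \<open>bool\<close> are
  enumerable, executable and linearly ordered lexicographically, as the search for minimal tables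
  requires.\<close>

type_synonym vec2 = "bool \<times> bool"
type_synonym struct_consts = "vec2 \<times> vec2 \<times> vec2 \<times> vec2"

fun add2 :: "vec2 \<Rightarrow> vec2 \<Rightarrow> vec2" where
  "add2 (a, b) (c, d) = (a \<noteq> c, b \<noteq> d)"

text \<open>The linear map that sends the standard basis to \<open>u\<close>, \<open>v\<close>.\<close>

fun comb :: "vec2 \<Rightarrow> vec2 \<Rightarrow> vec2 \<Rightarrow> vec2" where
  "comb u v (x, y) = add2 (if x then u else (False, False)) (if y then v else (False, False))"

text \<open>The table lists the products of the standard basis vectors \<open>e\<^sub>1\<close>, \<open>e\<^sub>2\<close> in the order
  \<open>e\<^sub>1e\<^sub>1, e\<^sub>1e\<^sub>2, e\<^sub>2e\<^sub>1, e\<^sub>2e\<^sub>2\<close>.\<close>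

fun mult2 :: "struct_consts \<Rightarrow> vec2 \<Rightarrow> vec2 \<Rightarrow> vec2" where
  "mult2 (p, q, r, s) x y = comb (comb p q y) (comb r s y) x"

text \<open>Inverse to \<open>comb u v\<close> because the only nonzero vectors are \<open>u\<close>, \<open>v\<close> and \<open>u + v\<close>;
  meaningless unless \<open>u\<close>, \<open>v\<close> is a basis.\<close>

definition coord :: "vec2 \<Rightarrow> vec2 \<Rightarrow> vec2 \<Rightarrow> vec2" where
  "coord u v w = (if w = (False, False) then w else if w = u then (True, False)
     else if w = v then (False, True) else (True, True))"

definition is_basis :: "vec2 \<Rightarrow> vec2 \<Rightarrow> bool" where
  "is_basis u v \<longleftrightarrow> u \<noteq> (False, False) \<and> v \<noteq> (False, False) \<and> u \<noteq> v"

definition change_basis :: "vec2 \<Rightarrow> vec2 \<Rightarrow> struct_consts \<Rightarrow> struct_consts" where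
  "change_basis u v m =
    (coord u v (mult2 m u u), coord u v (mult2 m u v),
     coord u v (mult2 m v u), coord u v (mult2 m v v))"

lemma add2_zero [simp]: "add2 u (False, False) = u" "add2 (False, False) u = u"
  by (cases u; simp)+

lemma add2_self [simp]: "add2 u u = (False, False)" "add2 u (add2 u v) = v"
  by (cases u; cases v; auto)+

lemma add2_assoc: "add2 (add2 u v) w = add2 u (add2 v w)"
  by (cases u; cases v; cases w; auto)

lemma add2_commute: "add2 u v = add2 v u"
  by (cases u; cases v; auto)

lemma add2_left_commute: "add2 u (add2 v w) = add2 v (add2 u w)"
  by (metis add2_assoc add2_commute)

lemmas add2_ac = add2_assoc add2_commute add2_left_commute

lemma comb_add: "comb u v (add2 x y) = add2 (comb u v x) (comb u v y)"
  by (cases x; cases y) (auto simp: add2_ac)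

lemma comb_add_coeffs: "comb (add2 u u') (add2 v v') x = add2 (comb u v x) (comb u' v' x)"
  by (cases x) (auto simp: add2_ac)

lemma mult2_add_left: "mult2 m (add2 x y) z = add2 (mult2 m x z) (mult2 m y z)"
  by (cases m) (simp add: comb_add)

lemma mult2_add_right: "mult2 m z (add2 x y) = add2 (mult2 m z x) (mult2 m z y)"
  by (cases m) (simp add: comb_add comb_add_coeffs)

lemma mult2_zero [simp]:
  "mult2 m (False, False) z = (False, False)" "mult2 m z (False, False) = (False, False)"
  by (cases m; cases z; simp)+

lemma mult2_units:
  "(mult2 m (True, False) (True, False), mult2 m (True, False) (False, True),
    mult2 m (False, True) (True, False), mult2 m (False, True) (False, True)) = m"
  by (cases m) simp

text \<open>The entries of a table are themselves products of the unit vectors, so the product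
  determines its table.\<close>

lemma mult2_eq_iff: "(\<forall>x y. mult2 m x y = mult2 n x y) \<longleftrightarrow> m = n"
  by (metis mult2_units)

text \<open>Over two elements every additive map is linear, hence fixed by its values on the two
  unit vectors.\<close>

lemma additive_eq_comb:
  assumes "\<And>x y. f (add2 x y) = add2 (f x) (f y)"
  shows "f x = comb (f (True, False)) (f (False, True)) x"
proof -
  have "f (False, False) = (False, False)"
    using assms[of "(False, False)" "(False, False)"] by simp
  moreover have "f (True, True) = add2 (f (True, False)) (f (False, True))"
    using assms[of "(True, False)" "(False, True)"] by simp
  ultimately show ?thesis
    by (cases x; cases "fst x"; cases "snd x") auto
qed

lemma coord_eq_iff:
  assumes "is_basis u v"
  shows "coord u v w = x \<longleftrightarrow> w = comb u v x"
  using assms by (cases u; cases v; cases w; cases x) (auto simp: is_basis_def coord_def)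

lemma bij_comb_iff: "bij (comb u v) \<longleftrightarrow> is_basis u v"
proof
  assume "bij (comb u v)"
  then have inj: "comb u v x = comb u v y \<longleftrightarrow> x = y" for x y
    by (simp add: bij_is_inj inj_eq)
  \<comment> \<open>Comparing the unit vectors with zero makes \<open>u\<close> and \<open>v\<close>
    nonzero; comparing them with each other makes \<open>u\<close> and \<open>v\<close>
    distinct.\<close>
  show "is_basis u v"
    using inj[of "(True, False)" "(False, False)"] inj[of "(False, True)" "(False, False)"]
      inj[of "(True, False)" "(False, True)"]
    by (auto simp: is_basis_def)
next
  assume "is_basis u v"
  then have "w = comb u v x \<longleftrightarrow> x = coord u v w" for x w
    using coord_eq_iff by metis
  then show "bij (comb u v)" unfolding bij_iff by metis
qed

lemma mult2_comb:
  "mult2 m (comb u v x) (comb u v y)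
    = mult2 (mult2 m u u, mult2 m u v, mult2 m v u, mult2 m v v) x y"
  by (cases x; cases y) (auto simp: mult2_add_left mult2_add_right add2_ac)

text \<open>Both sides of the homomorphism equation are bilinear in \<open>x\<close> and
  \<open>y\<close>, so they agree iff their tables agree; inverting \<open>comb u v\<close> entry by
  entry then solves for \<open>m\<close>.\<close>

lemma comb_hom_iff:
  assumes "is_basis u v"
  shows "(\<forall>x y. comb u v (mult2 m x y) = mult2 n (comb u v x) (comb u v y))
    \<longleftrightarrow> m = change_basis u v n"
proof -
  have *: "comb u v (mult2 m x y) = mult2 (comb u v p, comb u v q, comb u v r, comb u v s) x y"
    if "m = (p, q, r, s)" for p q r s x y
    using that by (cases x; cases y) (auto simp: comb_add)
  have eq_coord: "x = coord u v w \<longleftrightarrow> comb u v x = w" for x w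
    using coord_eq_iff[OF assms] by metis
  obtain p q r s where m: "m = (p, q, r, s)" by (cases m)
  show ?thesis
    unfolding *[OF m] mult2_comb mult2_eq_iff
    by (simp add: m change_basis_def eq_coord)
qed

lemma card_minimal_struct_consts:
  "card {m. \<forall>u v. is_basis u v \<longrightarrow> m \<le> change_basis u v m} = 52"
proof -
  let ?P = "\<lambda>m. \<forall>u v. is_basis u v \<longrightarrow> m \<le> change_basis u v m"
  \<comment> \<open>The evaluation runs through all 256 tables, the quantifiers over
    \<open>u\<close> and \<open>v\<close> being finite as well. Since \<open>enum\<close> lists each
    table once, the length is a cardinality.\<close>
  have "length (filter ?P Enum.enum) = 52" by code_simp
  moreover have "set (filter ?P Enum.enum) = {m. ?P m}"
    using enum_UNIV by auto
  moreover have "card (set (filter ?P Enum.enum)) = length (filter ?P Enum.enum)"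
    by (intro distinct_card distinct_filter enum_distinct)
  ultimately show ?thesis by (simp only:)
qed

subsection \<open>Algebras on the standard plane\<close>

text \<open>A scalar is \<open>0\<close> or \<open>1\<close>, so compatibility with scalars follows
  from additivity and the vector space laws.\<close>

lemma linear_over_bit_iff:
  fixes s :: "bit \<Rightarrow> 'v::ab_group_add \<Rightarrow> 'v" and s' :: "bit \<Rightarrow> 'w::ab_group_add \<Rightarrow> 'w"
  shows "Vector_Spaces.linear s s' f
    \<longleftrightarrow> vector_space s \<and> vector_space s' \<and> (\<forall>x y. f (x + y) = f x + f y)"
proof -
  have "f (s c x) = s' c (f x)"
    if s: "vector_space s" and s': "vector_space s'" and f: "\<And>x y. f (x + y) = f x + f y" for c x
  proof -
    interpret s: vector_space s by (fact s)
    interpret s': vector_space s' by (fact s')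
    have "f 0 = 0" using f[of 0 0] by simp
    then show ?thesis by (cases c) simp_all
  qed
  then show ?thesis by (auto simp: Vector_Spaces.linear_iff)
qed

lemma vector_space_over_bit_unique:
  fixes s s' :: "bit \<Rightarrow> 'v::ab_group_add \<Rightarrow> 'v"
  assumes "vector_space s" "vector_space s'"
  shows "s = s'"
proof -
  interpret s: vector_space s by fact
  interpret s': vector_space s' by fact
  have "s c x = s' c x" for c x by (cases c) simp_all
  then show ?thesis by blast
qed

definition vec_of :: "vec2 \<Rightarrow> bit ^ 2" where
  "vec_of x = vector [of_bool (fst x), of_bool (snd x)]"

definition code_of :: "bit ^ 2 \<Rightarrow> vec2" where
  "code_of v = (v $ 1 = 1, v $ 2 = 1)"

lemma code_of_vec_of [simp]: "code_of (vec_of x) = x"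
  by (cases x) (auto simp: code_of_def vec_of_def)

lemma vec_of_code_of [simp]: "vec_of (code_of v) = v"
  by (auto simp: code_of_def vec_of_def vec_eq_iff forall_2)

lemma code_of_add: "code_of (v + w) = add2 (code_of v) (code_of w)"
  by (cases "v $ 1"; cases "v $ 2"; cases "w $ 1"; cases "w $ 2") (auto simp: code_of_def)

lemma vec_of_add: "vec_of (add2 x y) = vec_of x + vec_of y"
  by (metis code_of_add code_of_vec_of vec_of_code_of)

lemma bij_vec_of: "bij vec_of" and bij_code_of: "bij code_of"
  by (rule o_bij[of code_of] o_bij[of vec_of]; simp add: fun_eq_iff)+

definition std_alg :: "struct_consts \<Rightarrow> (bit, bit ^ 2) alg" where
  "std_alg m = ((*s), \<lambda>v w. vec_of (mult2 m (code_of v) (code_of w)))"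

lemma inj_std_alg: "inj std_alg"
proof (rule injI)
  fix m n assume "std_alg m = std_alg n"
  then have "vec_of (mult2 m (code_of v) (code_of w)) = vec_of (mult2 n (code_of v) (code_of w))" for v w
    by (metis std_alg_def prod.inject)
  then have "mult2 m x y = mult2 n x y" for x y
    by (metis code_of_vec_of)
  then show "m = n" by (simp flip: mult2_eq_iff)
qed

text \<open>The scalar multiplication is forced, and a biadditive product is determined by the four
  products of the unit vectors, which form its table.\<close>

lemma two_dim_algebras_eq_range_std_alg: "two_dim_algebras = range std_alg"
proof
  show "range std_alg \<subseteq> two_dim_algebras"
    by (auto simp: std_alg_def two_dim_algebras_def card_cart_basis nonassoc_algebra_def
        nonassoc_algebra_axioms_def linear_over_bit_iff vec.vector_space_axioms
        code_of_add mult2_add_left mult2_add_right vec_of_add)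
  show "two_dim_algebras \<subseteq> range std_alg"
  proof
    fix A :: "(bit, bit ^ 2) alg" assume A: "A \<in> two_dim_algebras"
    obtain s mu where smu: "A = (s, mu)" by (cases A)
    then interpret nonassoc_algebra s mu using A by (simp add: two_dim_algebras_def)
    have s: "s = (*s)"
      using vector_space_axioms vec.vector_space_axioms by (rule vector_space_over_bit_unique)
    define g where "g x y = code_of (mu (vec_of x) (vec_of y))" for x y
    have left: "g (add2 x y) z = add2 (g x z) (g y z)"
      and right: "g z (add2 x y) = add2 (g z x) (g z y)" for x y z
      using linear_left linear_right
      by (simp_all add: linear_over_bit_iff g_def code_of_add vec_of_add)
    let ?m = "(g (True, False) (True, False), g (True, False) (False, True),
      g (False, True) (True, False), g (False, True) (False, True))"
    \<comment> \<open>Additivity in the first argument expands \<open>x\<close>; additivity in the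
      second expands \<open>y\<close> in the product with each unit vector.\<close>
    have "g x y = mult2 ?m x y" for x y
      using additive_eq_comb[of "\<lambda>x. g x y" x, OF left]
        additive_eq_comb[of "g (True, False)" y, OF right]
        additive_eq_comb[of "g (False, True)" y, OF right]
      by simp
    then have "mu v w = vec_of (mult2 ?m (code_of v) (code_of w))" for v w
      by (metis g_def vec_of_code_of)
    then have "A = std_alg ?m" by (simp add: smu s std_alg_def fun_eq_iff)
    then show "A \<in> range std_alg" by blast
  qed
qed

text \<open>An isomorphism carries the unit vectors to a basis \<open>u\<close>, \<open>v\<close>,
  and the structure constants of the target in that basis are those of the source in the unit
  vectors. Hence the source table \<open>m\<close> is the one obtained by a change of basis.\<close>

lemma std_alg_isomorphic_iff:
  "alg_isomorphic (std_alg m) (std_alg n) \<longleftrightarrow> (\<exists>u v. is_basis u v \<and> m = change_basis u v n)"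
proof
  assume "alg_isomorphic (std_alg m) (std_alg n)"
  then obtain f where add: "\<And>v w. f (v + w) = f v + f w" and bij: "bij f"
    and hom: "\<And>v w. f (vec_of (mult2 m (code_of v) (code_of w)))
      = vec_of (mult2 n (code_of (f v)) (code_of (f w)))"
    by (auto simp: alg_isomorphic_def std_alg_def linear_over_bit_iff)
  define g where "g = code_of \<circ> f \<circ> vec_of"
  have g_add: "g (add2 x y) = add2 (g x) (g y)" for x y
    by (simp add: g_def vec_of_add add code_of_add)
  obtain u v where g: "g = comb u v"
    using additive_eq_comb[of g, OF g_add] by blast
  have "bij g"
    unfolding g_def using bij bij_vec_of bij_code_of by (intro bij_comp)
  then have uv: "is_basis u v" by (simp add: g bij_comb_iff)
  have "g (mult2 m x y) = mult2 n (g x) (g y)" for x y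
    using hom[of "vec_of x" "vec_of y"] by (simp add: g_def)
  then show "\<exists>u v. is_basis u v \<and> m = change_basis u v n"
    using comb_hom_iff[OF uv] uv unfolding g by blast
next
  assume "\<exists>u v. is_basis u v \<and> m = change_basis u v n"
  then obtain u v where uv: "is_basis u v" and m: "m = change_basis u v n" by blast
  then have hom: "comb u v (mult2 m x y) = mult2 n (comb u v x) (comb u v y)" for x y
    using comb_hom_iff by blast
  let ?f = "vec_of \<circ> comb u v \<circ> code_of"
  have "bij ?f"
    using uv bij_vec_of bij_code_of by (intro bij_comp) (simp_all add: bij_comb_iff)
  then show "alg_isomorphic (std_alg m) (std_alg n)"
    by (auto simp: alg_isomorphic_def std_alg_def linear_over_bit_iff vec.vector_space_axioms
        code_of_add comb_add vec_of_add hom intro!: exI[of _ ?f])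
qed

section \<open>Counting the isomorphism classes\<close>

lemma card_two_dim_algebra_classes:
  "card (two_dim_algebra_classes :: (bit, bit ^ 2) alg set set) = 52"
proof -
  let ?R = "{(A :: (bit, bit ^ 2) alg, B :: (bit, bit ^ 2) alg).
    A \<in> two_dim_algebras \<and> B \<in> two_dim_algebras \<and> alg_isomorphic A B}"
  \<comment> \<open>The key \<open>inv std_alg\<close> carries the order on tables over to the
    algebras.\<close>
  have "card (two_dim_algebra_classes :: (bit, bit ^ 2) alg set set)
      = card {A \<in> two_dim_algebras. \<forall>B. (A, B) \<in> ?R \<longrightarrow> inv std_alg A \<le> inv std_alg B}"
    unfolding two_dim_algebra_classes_def
    using equiv_alg_isomorphic
    by (rule card_quotient_minima)
      (auto simp: two_dim_algebras_eq_range_std_alg inj_on_def inv_f_f[OF inj_std_alg])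
  also have "{A \<in> two_dim_algebras. \<forall>B. (A, B) \<in> ?R \<longrightarrow> inv std_alg A \<le> inv std_alg B}
      = std_alg ` {m. \<forall>u v. is_basis u v \<longrightarrow> m \<le> change_basis u v m}"
  proof -
    have R: "(std_alg m, B) \<in> ?R \<longleftrightarrow> (\<exists>u v. is_basis u v \<and> B = std_alg (change_basis u v m))" for m B
    proof -
      \<comment> \<open>Symmetry swaps the sides, since \<open>std_alg_isomorphic_iff\<close>
        describes the first algebra by a change of basis of the second, and here the orbit of
        \<open>m\<close> is wanted.\<close>
      have "(std_alg m, B) \<in> ?R \<longleftrightarrow> B \<in> range std_alg \<and> alg_isomorphic B (std_alg m)"
        by (simp add: two_dim_algebras_eq_range_std_alg alg_isomorphic_commute[of "std_alg m" B])
      also have "\<dots> \<longleftrightarrow> (\<exists>n. B = std_alg n \<and> alg_isomorphic (std_alg n) (std_alg m))"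
        by blast
      finally show ?thesis unfolding std_alg_isomorphic_iff by blast
    qed
    have minimal: "(\<forall>B. (std_alg m, B) \<in> ?R \<longrightarrow> inv std_alg (std_alg m) \<le> inv std_alg B)
        \<longleftrightarrow> (\<forall>u v. is_basis u v \<longrightarrow> m \<le> change_basis u v m)" for m
      unfolding R by (metis inv_f_f[OF inj_std_alg])
    have "{A \<in> two_dim_algebras. Q A} = std_alg ` {m. Q (std_alg m)}" for Q
      unfolding two_dim_algebras_eq_range_std_alg by blast
    then show ?thesis by (simp only: minimal)
  qed
  also have "card \<dots> = 52"
    by (simp only: card_image[OF inj_on_subset[OF inj_std_alg subset_UNIV]] card_minimal_struct_consts)
  finally show ?thesis .
qed

text \<open>Existence comes from transport to \<open>'f ^ 2\<close>, uniqueness from the fact that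
  all algebras isomorphic to \<open>A\<close> are isomorphic to one another. Thus the count on
  \<open>bit ^ 2\<close> is a count for every carrier.\<close>

lemma iso_class_unique:
  fixes A :: "('f::field, 'v::ab_group_add) alg"
  assumes "A \<in> two_dim_algebras"
  shows "\<exists>!C. C \<in> (two_dim_algebra_classes :: ('f, 'f ^ 2) alg set set)
    \<and> (\<exists>B \<in> C. alg_isomorphic A B)"
proof -
  let ?R = "{(A :: ('f, 'f ^ 2) alg, B :: ('f, 'f ^ 2) alg).
    A \<in> two_dim_algebras \<and> B \<in> two_dim_algebras \<and> alg_isomorphic A B}"
  obtain B :: "('f, 'f ^ 2) alg" where B: "B \<in> two_dim_algebras" "alg_isomorphic A B"
    using two_dim_algebra_iso_standard[OF assms] .
  show ?thesis
  proof (rule ex1I[of _ "?R `` {B}"])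
    show "?R `` {B} \<in> two_dim_algebra_classes \<and> (\<exists>B \<in> ?R `` {B}. alg_isomorphic A B)"
    proof
      show "?R `` {B} \<in> two_dim_algebra_classes"
        unfolding two_dim_algebra_classes_def using B(1) by (rule quotientI)
      show "\<exists>B \<in> ?R `` {B}. alg_isomorphic A B"
        using B alg_isomorphic_refl[OF B(1)] by blast
    qed
  next
    fix C :: "('f, 'f ^ 2) alg set"
    assume C: "C \<in> two_dim_algebra_classes \<and> (\<exists>B \<in> C. alg_isomorphic A B)"
    then obtain B' where B': "B' \<in> C" "alg_isomorphic A B'" by blast
    obtain D where D: "C = ?R `` {D}"
      using conjunct1[OF C] unfolding two_dim_algebra_classes_def by (rule quotientE) (rule that)
    have "alg_isomorphic B' B"
      using alg_isomorphic_trans[OF alg_isomorphic_sym[OF B'(2)] B(2)] .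
    moreover have "D \<in> two_dim_algebras" "alg_isomorphic D B'"
      using B'(1) unfolding D by blast+
    ultimately have "(D, B) \<in> ?R"
      using B(1) alg_isomorphic_trans[of D B' B] by blast
    then show "C = ?R `` {B}"
      unfolding D by (rule equiv_class_eq[OF equiv_alg_isomorphic])
  qed
qed

theorem mainTheorem4:
  shows "card (two_dim_algebra_classes :: (bit, bit ^ 2) alg set set) = 52
    \<and> (\<forall>A \<in> (two_dim_algebras :: (bit, 'v::ab_group_add) alg set).
          \<exists>!C. C \<in> (two_dim_algebra_classes :: (bit, bit ^ 2) alg set set)
               \<and> (\<exists>B \<in> C. alg_isomorphic A B))"
  using card_two_dim_algebra_classes by (intro conjI ballI iso_class_unique)

end
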